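(* For any $x=\bar x\,t_{-\lambda}=t_{-\nu}\,\bar x\in\widetilde{\mathcal W}^{(+)}$ (with $\bar x\in\overline W$, $\lambda\in P$, $\nu=\bar x(\lambda)$) the following equalities hold in $\mathbb Z[\widetilde W]$: $$\chi_x=\det(\bar x)\Big(\bar\chi_\nu+\gamma\,\bar\chi_{\nu-2\bar\Lambda_1}+\gamma^{-1}\bar\chi_{\nu-2\bar\Lambda_2}+(F+2)\big(\bar\chi_{\nu-\bar\rho}+\gamma\,\bar\chi_{\nu-\bar\Lambda_2}+\gamma^{-1}\bar\chi_{\nu-\bar\Lambda_1}\big)\Big)$$ $$=\bar\chi_{\lambda+\bar x^{-1}\cdot 0}+\gamma\,\bar\chi_{\lambda+\bar x^{-1}\cdot(-2\bar\Lambda_1)}+\gamma^{-1}\bar\chi_{\lambda+\bar x^{-1}\cdot(-2\bar\Lambda_2)}+(F+2)\big(\bar\chi_{\lambda+\bar x^{-1}\cdot(-\bar\rho)}+\gamma\,\bar\chi_{\lambda+\bar x^{-1}\cdot(-\bar\Lambda_2)}+\gamma^{-1}\bar\chi_{\lambda+\bar x^{-1}\cdot(-\bar\Lambda_1)}\big).$$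
   Context: Setting: $sl(3)$ with simple roots $\alpha_1,\alpha_2$, $\theta=\alpha_1+\alpha_2$, $\langle\alpha_i,\alpha_i\rangle=2$, root lattice $Q$, $Q^+=\mathbb Z_{\ge0}\alpha_1+\mathbb Z_{\ge0}\alpha_2$, weight lattice $P$, fundamental weights $\bar\Lambda_1,\bar\Lambda_2$, $\bar\rho=\bar\Lambda_1+\bar\Lambda_2$, dominant weights $P_+$. $\overline W$ is the finite Weyl group with simple reflections $w_1,w_2$, $\det(w)=\pm1$, shifted action $w\cdot\lambda=w(\lambda+\bar\rho)-\bar\rho$ on $P$, $w_\theta=w_1w_2w_1$. The extended affine Weyl group is $\widetilde W=\overline W\ltimes t_P$ (with $w\,t_\beta w^{-1}=t_{w(\beta)}$, $t_\beta t_{\beta'}=t_{\beta+\beta'}$), the affine Weyl group is $W=\overline W\ltimes t_Q$. Each $y\in\widetilde W$ is uniquely $y=\bar y\,t_{-\lambda}$, $\bar y\in\overline W$, $\lambda\in P$. Put $w_0=w_\theta t_{-\theta}$, $\gamma=t_{\bar\Lambda_1}w_1w_2$ (so $\gamma^3=1$), and $F=w_0+w_1+w_2\in\mathbb Z[\widetilde W]$. $\iota:\widetilde W\to Q$, $\iota(\bar y\,t_{-\lambda})=3\lambda+\bar y^{-1}\cdot0$. $\widetilde{\mathcal W}^{(+)}=\{\bar y\,t_{-\lambda}\in\widetilde W:\lambda\in P_+,\ \langle\lambda,\alpha_i\rangle>0 \text{ whenever } \bar y(\alpha_i)\text{ is a negative root},\ i=1,2\}$. Let $K_\beta$ be the Kostant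 partition function of $sl(3)$ (the number of ways to write $\beta$ as a sum of positive roots with nonnegative multiplicities; $0$ if $\beta\notin Q^+$). For $\lambda,\mu\in P$ put $\bar m^\lambda_\mu=\sum_{w\in\overline W}\det(w)K_{w\cdot\lambda-\mu}$ (for $\lambda\in P_+$ this is the multiplicity of the weight $\mu$ in the irreducible $sl(3)$-module of highest weight $\lambda$), and $\bar\chi_\lambda=\sum_{\mu\in P}\bar m^\lambda_\mu\,t_{-\mu}\in\mathbb Z[t_P]\subset\mathbb Z[\widetilde W]$. For $y\in\widetilde W$ put $\mathrm{ch}(\mathcal V_y)=\sum_{z\in Wy}K_{\iota(y)-\iota(z)}\,z$ (a formal series) and $\chi_y=\sum_{w\in\overline W}\det(w)\,\mathrm{ch}(\mathcal V_{yw})=\sum_{z\in Wy}m^y_z\,z$, where $m^y_z=\bar m^{\iota(y)}_{\iota(z)}$ for $z\in Wy$ and $m^y_z=0$ otherwise; this is a finite sum, an element of $\mathbb Z[\widetilde W]$. *)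

theory Defs
  imports "HOL-Library.Poly_Mapping" "HOL-Library.Product_Plus"
begin

section \<open>Weights of sl(3)\<close>

text \<open>The pair \<open>(a, b)\<close> is the weight with Dynkin labels \<open>a\<close> and \<open>b\<close>, that is
  \<open>a \<Lambda>\<^sub>1 + b \<Lambda>\<^sub>2\<close>.  Hence \<open>fst lam\<close> and \<open>snd lam\<close> are \<open>\<langle>lam, \<alpha>\<^sub>1\<rangle>\<close> and \<open>\<langle>lam, \<alpha>\<^sub>2\<rangle>\<close>, and the labels
  of the simple roots are the rows of the Cartan matrix.\<close>

type_synonym weight = "int \<times> int"

definition zscale :: "int \<Rightarrow> weight \<Rightarrow> weight"  (infixr "*\<^sub>Z" 75)
  where "k *\<^sub>Z lam = (k * fst lam, k * snd lam)"

definition Lambda1 :: weight  ("\<Lambda>\<^sub>1") where "\<Lambda>\<^sub>1 = (1, 0)"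
definition Lambda2 :: weight  ("\<Lambda>\<^sub>2") where "\<Lambda>\<^sub>2 = (0, 1)"
definition alpha1 :: weight  ("\<alpha>\<^sub>1") where "\<alpha>\<^sub>1 = (2, -1)"
definition alpha2 :: weight  ("\<alpha>\<^sub>2") where "\<alpha>\<^sub>2 = (-1, 2)"
definition theta :: weight  ("\<theta>") where "\<theta> = \<alpha>\<^sub>1 + \<alpha>\<^sub>2"
definition rho :: weight  ("\<rho>") where "\<rho> = \<Lambda>\<^sub>1 + \<Lambda>\<^sub>2"

definition positive_roots :: "weight set" where "positive_roots = {\<alpha>\<^sub>1, \<alpha>\<^sub>2, \<theta>}"
definition negative_roots :: "weight set" where "negative_roots = uminus ` positive_roots"

definition root_lattice :: "weight set"
  where "root_lattice = {a *\<^sub>Z \<alpha>\<^sub>1 + b *\<^sub>Z \<alpha>\<^sub>2 | a b. True}"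

definition dominant_weights :: "weight set"
  where "dominant_weights = {lam. 0 \<le> fst lam \<and> 0 \<le> snd lam}"


section \<open>The finite Weyl group\<close>

definition refl1 :: "weight \<Rightarrow> weight" where "refl1 lam = lam - fst lam *\<^sub>Z \<alpha>\<^sub>1"
definition refl2 :: "weight \<Rightarrow> weight" where "refl2 lam = lam - snd lam *\<^sub>Z \<alpha>\<^sub>2"

text \<open>The reflections are involutions, so the monoid they generate is a group.\<close>

inductive_set weyl_maps :: "(weight \<Rightarrow> weight) set" where
  weyl_id: "id \<in> weyl_maps"
| weyl_refl1: "w \<in> weyl_maps \<Longrightarrow> refl1 \<circ> w \<in> weyl_maps"
| weyl_refl2: "w \<in> weyl_maps \<Longrightarrow> refl2 \<circ> w \<in> weyl_maps"

lemmas weight_defs = zscale_def Lambda1_def Lambda2_def alpha1_def alpha2_def theta_def rho_def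
  refl1_def refl2_def

lemma refl_simps [simp]:
  "refl1 (a, b) = (- a, a + b)" "refl2 (a, b) = (a + b, - b)"
  by (simp_all add: weight_defs)

lemma refl_refl [simp]: "refl1 (refl1 x) = x" "refl2 (refl2 x) = x"
  by (cases x; simp)+

lemma weyl_comp: "v \<in> weyl_maps \<Longrightarrow> w \<in> weyl_maps \<Longrightarrow> v \<circ> w \<in> weyl_maps"
  by (induction rule: weyl_maps.induct) (auto simp: comp_assoc intro: weyl_maps.intros)

lemma weyl_gens: "refl1 \<in> weyl_maps" "refl2 \<in> weyl_maps"
  using weyl_refl1[OF weyl_id] weyl_refl2[OF weyl_id] by simp_all

lemma refl_bij: "bij refl1" "bij refl2"
  by (rule o_bij[of refl1], auto, rule o_bij[of refl2], auto)

lemma refl_inv: "inv refl1 = refl1" "inv refl2 = refl2"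
  by (rule inv_unique_comp; auto simp: fun_eq_iff)+

lemma weyl_bij: "w \<in> weyl_maps \<Longrightarrow> bij w"
  by (induction rule: weyl_maps.induct) (simp_all only: bij_id bij_comp refl_bij)

lemma weyl_inv: "w \<in> weyl_maps \<Longrightarrow> inv w \<in> weyl_maps"
  by (induction rule: weyl_maps.induct)
    (simp_all only: inv_id weyl_id o_inv_distrib weyl_bij weyl_comp weyl_gens refl_bij refl_inv)

typedef weyl = weyl_maps morphisms act Abs_weyl
  using weyl_id by blast

setup_lifting type_definition_weyl

instantiation weyl :: "{monoid_mult, inverse}"
begin

lift_definition one_weyl :: weyl is id by (rule weyl_id)
lift_definition times_weyl :: "weyl \<Rightarrow> weyl \<Rightarrow> weyl" is "(\<circ>)" by (rule weyl_comp)
lift_definition inverse_weyl :: "weyl \<Rightarrow> weyl" is inv by (rule weyl_inv)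
definition divide_weyl :: "weyl \<Rightarrow> weyl \<Rightarrow> weyl" where "divide_weyl v w = v * inverse w"

instance by standard (transfer; simp add: comp_assoc)+

end

lift_definition s1 :: weyl  ("w\<^sub>1") is refl1 by (rule weyl_gens)
lift_definition s2 :: weyl  ("w\<^sub>2") is refl2 by (rule weyl_gens)

definition s_theta :: weyl  ("w\<^sub>\<theta>") where "w\<^sub>\<theta> = w\<^sub>1 * w\<^sub>2 * w\<^sub>1"

text \<open>The determinant of the matrix of \<open>w\<close> in the basis \<open>\<Lambda>\<^sub>1, \<Lambda>\<^sub>2\<close>.\<close>

definition wdet :: "weyl \<Rightarrow> int"
  where "wdet w = fst (act w \<Lambda>\<^sub>1) * snd (act w \<Lambda>\<^sub>2) - fst (act w \<Lambda>\<^sub>2) * snd (act w \<Lambda>\<^sub>1)"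

definition shifted_act :: "weyl \<Rightarrow> weight \<Rightarrow> weight"  (infixr "\<odot>" 75)
  where "w \<odot> lam = act w (lam + \<rho>) - \<rho>"

lemma act_simps [simp]:
  "act 1 x = x" "act (v * w) x = act v (act w x)" "act w\<^sub>1 x = refl1 x" "act w\<^sub>2 x = refl2 x"
  by (simp_all add: one_weyl.rep_eq times_weyl.rep_eq s1.rep_eq s2.rep_eq)

lemma weyl_inverse [simp]: "inverse w * w = 1" "w * inverse (w :: weyl) = 1"
proof -
  show "inverse w * w = 1" for w :: weyl
    by transfer (metis weyl_bij bij_is_inj inj_iff)
  show "w * inverse w = 1" for w :: weyl
    by transfer (metis weyl_bij bij_is_surj surj_iff)
qed

lemma act_inverse [simp]: "act (inverse w) (act w x) = x" "act w (act (inverse w) x) = x"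
  by (simp_all flip: act_simps(2))

lemma act_eqI: "act v = act w \<Longrightarrow> v = w"
  by (simp add: act_inject)

lemma weyl_maps_cases:
  assumes "w \<in> weyl_maps"
  shows "w \<in> {id, refl1, refl2, refl1 \<circ> refl2, refl2 \<circ> refl1, refl1 \<circ> refl2 \<circ> refl1}"
  using assms
proof (induction rule: weyl_maps.induct)
  case (weyl_refl1 w)
  then show ?case by (auto simp: fun_eq_iff)
next
  case (weyl_refl2 w)
  have "refl2 \<circ> (refl1 \<circ> refl2 \<circ> refl1) = refl1 \<circ> refl2"
    "refl2 \<circ> (refl1 \<circ> refl2) = refl1 \<circ> refl2 \<circ> refl1" by (auto simp: fun_eq_iff)
  with weyl_refl2 show ?case by (auto simp: comp_assoc[symmetric] fun_eq_iff)
qed simp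

lemma UNIV_weyl: "(UNIV :: weyl set) = {1, w\<^sub>1, w\<^sub>2, w\<^sub>1 * w\<^sub>2, w\<^sub>2 * w\<^sub>1, w\<^sub>\<theta>}"
proof -
  have "w \<in> {1, w\<^sub>1, w\<^sub>2, w\<^sub>1 * w\<^sub>2, w\<^sub>2 * w\<^sub>1, w\<^sub>\<theta>}" for w :: weyl
    using weyl_maps_cases[OF act, of w] unfolding s_theta_def
    by (auto simp flip: act_inject simp: fun_eq_iff)
  then show ?thesis by blast
qed

instance weyl :: finite
  by standard (simp add: UNIV_weyl)

lemma weyl_distinct: "distinct [1, w\<^sub>1, w\<^sub>2, w\<^sub>1 * w\<^sub>2, w\<^sub>2 * w\<^sub>1, w\<^sub>\<theta>]"
proof -
  have "distinct (map (\<lambda>w. act w (1, 2)) [1, w\<^sub>1, w\<^sub>2, w\<^sub>1 * w\<^sub>2, w\<^sub>2 * w\<^sub>1, w\<^sub>\<theta>])"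
    by (simp add: s_theta_def)
  then show ?thesis by (simp only: distinct_map)
qed

lemma sum_weyl:
  "(\<Sum>w\<in>UNIV. f w) = f 1 + f w\<^sub>1 + f w\<^sub>2 + f (w\<^sub>1 * w\<^sub>2) + f (w\<^sub>2 * w\<^sub>1) + f w\<^sub>\<theta>"
  for f :: "weyl \<Rightarrow> 'a::comm_monoid_add"
  using weyl_distinct by (simp add: UNIV_weyl add.assoc)

lemma weyl_all: "(\<forall>w. P w) \<longleftrightarrow> (\<forall>w\<in>{1, w\<^sub>1, w\<^sub>2, w\<^sub>1 * w\<^sub>2, w\<^sub>2 * w\<^sub>1, w\<^sub>\<theta>}. P w)"
  using UNIV_weyl by (metis UNIV_I)

lemma wdet_simps [simp]:
  "wdet 1 = 1" "wdet w\<^sub>1 = -1" "wdet w\<^sub>2 = -1" "wdet (w\<^sub>1 * w\<^sub>2) = 1" "wdet (w\<^sub>2 * w\<^sub>1) = 1"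
  "wdet w\<^sub>\<theta> = -1"
  by (simp_all add: wdet_def Lambda1_def Lambda2_def s_theta_def)

lemma act_add: "act w (x + y) = act w x + act w y"
  and act_uminus: "act w (- x) = - act w x"
  and act_zscale: "act w (k *\<^sub>Z x) = k *\<^sub>Z act w x"
  and act_0 [simp]: "act w 0 = 0"
proof -
  have "\<forall>w. act w (x + y) = act w x + act w y \<and> act w (- x) = - act w x
      \<and> act w (k *\<^sub>Z x) = k *\<^sub>Z act w x \<and> act w 0 = 0"
    unfolding weyl_all
    by (cases x; cases y) (simp add: s_theta_def zscale_def zero_prod_def algebra_simps)
  then show "act w (x + y) = act w x + act w y" "act w (- x) = - act w x"
    "act w (k *\<^sub>Z x) = k *\<^sub>Z act w x" "act w 0 = 0" by blast+
qed

lemma weyl_inverse_eqI: "v * w = 1 \<Longrightarrow> inverse v = (w :: weyl)"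
  by (metis mult.assoc mult_1 mult_1_right weyl_inverse(1))

lemma inverse_inverse_weyl [simp]: "inverse (inverse w) = (w :: weyl)"
  by (rule weyl_inverse_eqI) simp

lemma inverse_weyl_mult: "inverse (v * w) = inverse w * inverse (v :: weyl)"
  by (rule weyl_inverse_eqI) (metis mult.assoc mult_1_right weyl_inverse(2))

lemma inverse_weyl_simps [simp]:
  "inverse (1 :: weyl) = 1" "inverse w\<^sub>1 = w\<^sub>1" "inverse w\<^sub>2 = w\<^sub>2" "inverse w\<^sub>\<theta> = w\<^sub>\<theta>"
proof -
  have *: "w\<^sub>1 * w\<^sub>1 = 1" "w\<^sub>2 * w\<^sub>2 = 1" by (rule act_eqI; simp add: fun_eq_iff)+
  then show "inverse (1 :: weyl) = 1" "inverse w\<^sub>1 = w\<^sub>1" "inverse w\<^sub>2 = w\<^sub>2"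
    by (simp_all add: weyl_inverse_eqI)
  then show "inverse w\<^sub>\<theta> = w\<^sub>\<theta>"
    by (simp add: s_theta_def inverse_weyl_mult mult.assoc)
qed

lemma wdet_inverse: "wdet (inverse w) = wdet w"
proof -
  have "\<forall>w. wdet (inverse w) = wdet w" unfolding weyl_all by (simp add: inverse_weyl_mult)
  then show ?thesis ..
qed


section \<open>The extended affine Weyl group and its group ring\<close>

text \<open>\<open>Xaff w \<beta>\<close> is the element \<open>w t\<^sub>\<beta>\<close> of the semidirect product; the finite part is on the left.\<close>

datatype xaff = Xaff (fin_part: weyl) (tr_part: weight)

instantiation xaff :: "{monoid_mult, inverse}"
begin

definition one_xaff :: xaff where "1 = Xaff 1 0"

definition times_xaff :: "xaff \<Rightarrow> xaff \<Rightarrow> xaff"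
  where "x * y = Xaff (fin_part x * fin_part y)
                      (act (inverse (fin_part y)) (tr_part x) + tr_part y)"

definition inverse_xaff :: "xaff \<Rightarrow> xaff"
  where "inverse x = Xaff (inverse (fin_part x)) (- act (fin_part x) (tr_part x))"

definition divide_xaff :: "xaff \<Rightarrow> xaff \<Rightarrow> xaff"
  where "divide_xaff x y = x * inverse y"

instance
  by standard (simp_all add: times_xaff_def one_xaff_def mult.assoc act_add add.assoc
    inverse_weyl_mult)

end

definition fin :: "weyl \<Rightarrow> xaff" where "fin w = Xaff w 0"
definition t :: "weight \<Rightarrow> xaff" where "t \<beta> = Xaff 1 \<beta>"

lemma xaff_inverse: "inverse x * x = 1" "x * inverse x = (1 :: xaff)"
  by (simp_all add: inverse_xaff_def times_xaff_def one_xaff_def act_uminus)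

lemma xaff_semidirect:
  "Xaff w \<beta> = fin w * t \<beta>" "fin (v * w) = fin v * fin w" "t (\<beta> + \<beta>') = t \<beta> * t \<beta>'"
  "fin w * t \<beta> * inverse (fin w) = t (act w \<beta>)"
  "fin w * t (- lam) = t (- act w lam) * fin w"
  by (simp_all add: fin_def t_def times_xaff_def inverse_xaff_def act_uminus)

text \<open>The convolution product on finitely supported functions requires the index monoid to be
  written additively, so the group operation also serves as \<open>+\<close>.  With this instance,
  \<open>xaff \<Rightarrow>\<^sub>0 int\<close> is the group ring.\<close>

instantiation xaff :: monoid_add
begin
definition plus_xaff :: "xaff \<Rightarrow> xaff \<Rightarrow> xaff" where "plus_xaff x y = x * y"
definition zero_xaff :: xaff where "zero_xaff = 1"
instance by standard (simp_all add: plus_xaff_def zero_xaff_def mult.assoc)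
end

type_synonym group_ring = "xaff \<Rightarrow>\<^sub>0 int"

definition gr :: "xaff \<Rightarrow> group_ring" where "gr x = Poly_Mapping.single x 1"

lemma gr_mult: "gr x * gr y = gr (x * y)" and gr_one: "gr 1 = 1"
  by (simp_all add: gr_def mult_single plus_xaff_def zero_xaff_def flip: single_one)

definition affine_weyl :: "xaff set"
  where "affine_weyl = {fin w * t \<beta> | w \<beta>. \<beta> \<in> root_lattice}"

definition coset :: "xaff \<Rightarrow> xaff set"
  where "coset y = (\<lambda>u. u * y) ` affine_weyl"

definition w0 :: xaff  ("w\<^sub>0") where "w\<^sub>0 = fin w\<^sub>\<theta> * t (- \<theta>)"
definition gam :: xaff  ("\<gamma>") where "\<gamma> = t \<Lambda>\<^sub>1 * fin w\<^sub>1 * fin w\<^sub>2"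
definition F :: group_ring where "F = gr w\<^sub>0 + gr (fin w\<^sub>1) + gr (fin w\<^sub>2)"

text \<open>The defining formula is for \<open>y = fin w * t (- lam)\<close>, so \<open>lam = - tr_part y\<close>.\<close>

definition iota :: "xaff \<Rightarrow> weight"  ("\<iota>")
  where "\<iota> y = 3 *\<^sub>Z (- tr_part y) + inverse (fin_part y) \<odot> 0"

definition W_plus :: "xaff set"
  where "W_plus = {fin w * t (- lam) | w lam. lam \<in> dominant_weights
           \<and> (act w \<alpha>\<^sub>1 \<in> negative_roots \<longrightarrow> 0 < fst lam)
           \<and> (act w \<alpha>\<^sub>2 \<in> negative_roots \<longrightarrow> 0 < snd lam)}"

lemma gam_cubed: "\<gamma> ^ 3 = 1"
proof -
  have g: "\<gamma> = Xaff (w\<^sub>1 * w\<^sub>2) (0, -1)"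
    by (simp add: gam_def times_xaff_def fin_def t_def Lambda1_def)
  moreover have "w\<^sub>1 * w\<^sub>2 * (w\<^sub>1 * w\<^sub>2 * (w\<^sub>1 * w\<^sub>2)) = 1" by (rule act_eqI) (auto simp: fun_eq_iff)
  ultimately show ?thesis
    by (simp add: g power3_eq_cube times_xaff_def one_xaff_def inverse_weyl_mult zero_prod_def
        mult.assoc)
qed


section \<open>Kostant partition function and characters\<close>

definition kostant :: "weight \<Rightarrow> nat"
  where "kostant \<beta> = card {(a :: nat, b :: nat, c :: nat).
           \<beta> = int a *\<^sub>Z \<alpha>\<^sub>1 + int b *\<^sub>Z \<alpha>\<^sub>2 + int c *\<^sub>Z \<theta>}"

definition mbar :: "weight \<Rightarrow> weight \<Rightarrow> int"
  where "mbar lam \<mu> = (\<Sum>w\<in>UNIV. wdet w * int (kostant (w \<odot> lam - \<mu>)))"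

definition chibar :: "weight \<Rightarrow> group_ring"
  where "chibar lam = Sum_any (\<lambda>\<mu>. Poly_Mapping.single (t (- \<mu>)) (mbar lam \<mu>))"

text \<open>A formal series over the group is its coefficient function.\<close>

definition ch_V :: "xaff \<Rightarrow> xaff \<Rightarrow> int"
  where "ch_V y z = (if z \<in> coset y then int (kostant (\<iota> y - \<iota> z)) else 0)"

lemma kostant_root:
  "int (kostant (2 * a - b, 2 * b - a)) = (if 0 \<le> a \<and> 0 \<le> b then min a b + 1 else 0)"
proof -
  let ?S = "{(i :: nat, j :: nat, k :: nat). (2 * a - b, 2 * b - a)
               = int i *\<^sub>Z \<alpha>\<^sub>1 + int j *\<^sub>Z \<alpha>\<^sub>2 + int k *\<^sub>Z \<theta>}"
  have S: "?S = {(i, j, k). int i + int k = a \<and> int j + int k = b}"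
    by (auto simp: weight_defs algebra_simps; presburger)
  show ?thesis
  proof (cases "0 \<le> a \<and> 0 \<le> b")
    case True
    have "?S = (\<lambda>k. (nat a - k, nat b - k, k)) ` {..nat (min a b)}"
      unfolding S using True by (auto simp: image_iff)
    moreover have "inj (\<lambda>k. (nat a - k, nat b - k, k))" by (auto simp: inj_on_def)
    ultimately have "card ?S = card {..nat (min a b)}"
      by (simp add: card_image inj_on_subset)
    then show ?thesis using True by (simp add: kostant_def)
  next
    case False
    then have "?S = {}" unfolding S by auto
    then have "kostant (2 * a - b, 2 * b - a) = 0" by (simp only: kostant_def card.empty)
    with False show ?thesis by auto
  qed
qed

lemma root_lattice_iff: "\<beta> \<in> root_lattice \<longleftrightarrow> (\<exists>a b. \<beta> = (2 * a - b, 2 * b - a))"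
  by (auto simp: root_lattice_def weight_defs algebra_simps)

lemma kostant_eq_0:
  assumes "\<beta> \<notin> root_lattice"
  shows "kostant \<beta> = 0"
proof -
  have "{(a :: nat, b :: nat, c :: nat).
      \<beta> = int a *\<^sub>Z \<alpha>\<^sub>1 + int b *\<^sub>Z \<alpha>\<^sub>2 + int c *\<^sub>Z \<theta>} = {}"
  proof (safe, goal_cases)
    case (1 a b c)
    have "\<beta> = (int a + int c) *\<^sub>Z \<alpha>\<^sub>1 + (int b + int c) *\<^sub>Z \<alpha>\<^sub>2"
      using 1 by (simp add: weight_defs algebra_simps)
    with assms show ?case by (auto simp: root_lattice_def)
  qed
  then show ?thesis by (simp only: kostant_def card.empty)
qed

lemma root_lattice_add:
  assumes "x \<in> root_lattice" "y \<in> root_lattice"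
  shows "x + y \<in> root_lattice"
proof -
  obtain a b c d where "x = (2 * a - b, 2 * b - a)" "y = (2 * c - d, 2 * d - c)"
    using assms by (auto simp: root_lattice_iff)
  then have "x + y = (2 * (a + c) - (b + d), 2 * (b + d) - (a + c))" by simp
  then show ?thesis unfolding root_lattice_iff by blast
qed

lemma root_lattice_uminus:
  assumes "x \<in> root_lattice"
  shows "- x \<in> root_lattice"
proof -
  obtain a b where "x = (2 * a - b, 2 * b - a)"
    using assms by (auto simp: root_lattice_iff)
  then have "- x = (2 * (- a) - (- b), 2 * (- b) - (- a))" by simp
  then show ?thesis unfolding root_lattice_iff by blast
qed

lemma act_diff_root_lattice: "act w x - x \<in> root_lattice"
proof -
  obtain p q where x: "x = (p, q)" by (cases x)
  have I: "y \<in> root_lattice" if "y = (2 * a - b, 2 * b - a)" for y a b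
    using that root_lattice_iff by blast
  have "\<forall>w. act w x - x \<in> root_lattice"
    unfolding weyl_all x
    using I[of _ 0 0] I[of _ "- p" 0] I[of _ 0 "- q"] I[of _ "- p - q" "- q"]
      I[of _ "- p" "- p - q"] I[of "(- q - p, - p - q)" "- p - q" "- p - q"]
    by (simp add: s_theta_def zero_prod_def algebra_simps)
  then show ?thesis ..
qed

lemma act_root_lattice: "x \<in> root_lattice \<Longrightarrow> act w x \<in> root_lattice"
  using root_lattice_add[OF act_diff_root_lattice[of w x], of x] by simp

lemma finite_mbar: "finite {\<mu>. mbar lam \<mu> \<noteq> 0}"
proof -
  obtain p q where lam: "lam = (p - 1, q - 1)"
    using that[of "fst lam + 1" "snd lam + 1"] by simp
  define N where "N = 3 * (\<bar>p\<bar> + \<bar>q\<bar>)"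
  define k where "k = (\<lambda>a b :: int. if 0 \<le> a \<and> 0 \<le> b then min a b + 1 else 0)"
  have "\<exists>a\<in>{-N..N}. \<exists>b\<in>{-N..N}. \<mu> = (fst lam - (2 * a - b), snd lam - (2 * b - a))"
    if nz: "mbar lam \<mu> \<noteq> 0" for \<mu>
  proof -
    have "\<exists>w. kostant (w \<odot> lam - \<mu>) \<noteq> 0"
    proof (rule ccontr)
      assume "\<nexists>w. kostant (w \<odot> lam - \<mu>) \<noteq> 0"
      then have "mbar lam \<mu> = 0" by (simp add: mbar_def)
      with nz show False ..
    qed
    then obtain w where "kostant (w \<odot> lam - \<mu>) \<noteq> 0" ..
    then have "w \<odot> lam - \<mu> \<in> root_lattice" by (rule contrapos_np) (rule kostant_eq_0)
    moreover have "- (w \<odot> lam - lam) \<in> root_lattice"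
      using root_lattice_uminus[OF act_diff_root_lattice[of w "lam + \<rho>"]]
      by (simp add: shifted_act_def algebra_simps)
    ultimately have "lam - \<mu> \<in> root_lattice"
      using root_lattice_add[of "w \<odot> lam - \<mu>" "- (w \<odot> lam - lam)"] by simp
    then obtain a b where ab: "lam - \<mu> = (2 * a - b, 2 * b - a)"
      by (auto simp: root_lattice_iff)
    then have mu: "\<mu> = (p - 1 - (2 * a - b), q - 1 - (2 * b - a))"
      by (cases \<mu>) (auto simp: lam)
    have K: "int (kostant x) = k a' b'" if "x = (2 * a' - b', 2 * b' - a')" for x a' b'
      unfolding that k_def by (rule kostant_root)
    have "mbar lam \<mu> = k a b - k (a - p) b - k a (b - q) + k (a - p - q) (b - q)
        + k (a - p) (b - p - q) - k (a - p - q) (b - p - q)"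
      unfolding mbar_def sum_weyl
      by (subst K[of _ a b], simp add: shifted_act_def mu lam weight_defs,
          subst K[of _ "a - p" b], simp add: shifted_act_def mu lam rho_def Lambda1_def Lambda2_def,
          subst K[of _ a "b - q"], simp add: shifted_act_def mu lam rho_def Lambda1_def Lambda2_def,
          subst K[of _ "a - p - q" "b - q"],
          simp add: shifted_act_def mu lam rho_def Lambda1_def Lambda2_def,
          subst K[of _ "a - p" "b - p - q"],
          simp add: shifted_act_def mu lam rho_def Lambda1_def Lambda2_def,
          subst K[of _ "a - p - q" "b - p - q"],
          simp add: shifted_act_def s_theta_def mu lam rho_def Lambda1_def Lambda2_def)
        simp
    moreover have "\<dots> = 0" if outside: "\<not> (\<bar>a\<bar> \<le> N \<and> \<bar>b\<bar> \<le> N)"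
    proof -
      obtain P Q where PQ: "P = \<bar>p\<bar>" "Q = \<bar>q\<bar>" by blast
      then have pq: "p \<le> P" "- P \<le> p" "q \<le> Q" "- Q \<le> q" "0 \<le> P" "0 \<le> Q" by linarith+
      consider "a < - P - Q" | "b < - P - Q"
        | "P + Q \<le> a" "P + Q \<le> b"
        | "3 * P + 3 * Q \<le> a" "b < P + Q"
        | "3 * P + 3 * Q \<le> b" "a < P + Q"
        using outside unfolding N_def PQ by (smt (verit))
      then show ?thesis
      proof cases
        case 1
        then have "\<not> 0 \<le> a" "\<not> 0 \<le> a - p" "\<not> 0 \<le> a - p - q" using pq by linarith+
        then show ?thesis by (simp add: k_def)
      next
        case 2
        then have "\<not> 0 \<le> b" "\<not> 0 \<le> b - q" "\<not> 0 \<le> b - p - q" using pq by linarith+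
        then show ?thesis by (simp add: k_def)
      next
        case 3
        then have "0 \<le> a" "0 \<le> b" "0 \<le> a - p" "0 \<le> b - q" "0 \<le> a - p - q" "0 \<le> b - p - q"
          using pq by linarith+
        then have "k a b = min a b + 1" "k (a - p) b = min (a - p) b + 1"
          "k a (b - q) = min a (b - q) + 1" "k (a - p - q) (b - q) = min (a - p - q) (b - q) + 1"
          "k (a - p) (b - p - q) = min (a - p) (b - p - q) + 1"
          "k (a - p - q) (b - p - q) = min (a - p - q) (b - p - q) + 1"
          unfolding k_def by simp_all
        then show ?thesis by (simp add: min_def)
      next
        case 4
        then have "b \<le> a" "b \<le> a - p" "b - q \<le> a" "b - q \<le> a - p - q" "b - p - q \<le> a - p"
          "b - p - q \<le> a - p - q" "0 \<le> a" "0 \<le> a - p" "0 \<le> a - p - q"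
          using pq by linarith+
        then have "k a b = k b b" "k (a - p) b = k b b"
          "k a (b - q) = k (b - q) (b - q)" "k (a - p - q) (b - q) = k (b - q) (b - q)"
          "k (a - p) (b - p - q) = k (b - p - q) (b - p - q)"
          "k (a - p - q) (b - p - q) = k (b - p - q) (b - p - q)"
          unfolding k_def min_def by auto
        then show ?thesis by simp
      next
        case 5
        then have "a \<le> b" "a \<le> b - q" "a - p \<le> b" "a - p - q \<le> b - q" "a - p \<le> b - p - q"
          "a - p - q \<le> b - p - q" "0 \<le> b" "0 \<le> b - q" "0 \<le> b - p - q"
          using pq by linarith+
        then have "k a b = k a a" "k a (b - q) = k a a" 
          "k (a - p) b = k (a - p) (a - p)" "k (a - p) (b - p - q) = k (a - p) (a - p)"
          "k (a - p - q) (b - q) = k (a - p - q) (a - p - q)"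
          "k (a - p - q) (b - p - q) = k (a - p - q) (a - p - q)"
          unfolding k_def min_def by auto
        then show ?thesis by simp
      qed
    qed
    ultimately have "\<bar>a\<bar> \<le> N \<and> \<bar>b\<bar> \<le> N" using nz by metis
    then show ?thesis
      by (intro bexI[of _ a] bexI[of _ b]) (auto simp: mu lam)
  qed
  then have "{\<mu>. mbar lam \<mu> \<noteq> 0} \<subseteq>
      (\<lambda>(a, b). (fst lam - (2 * a - b), snd lam - (2 * b - a))) ` ({-N..N} \<times> {-N..N})"
    by (force simp: image_iff)
  then show ?thesis by (rule finite_subset) simp
qed

lemma lookup_chibar:
  "Poly_Mapping.lookup (chibar lam) z = (if fin_part z = 1 then mbar lam (- tr_part z) else 0)"
proof -
  have "chibar lam = (\<Sum>\<mu> | mbar lam \<mu> \<noteq> 0. Poly_Mapping.single (t (- \<mu>)) (mbar lam \<mu>))"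
    unfolding chibar_def Sum_any.expand_set
    by (rule sum.cong) (auto simp flip: keys_eq_empty)
  then have "Poly_Mapping.lookup (chibar lam) z
      = (\<Sum>\<mu> | mbar lam \<mu> \<noteq> 0. mbar lam \<mu> when t (- \<mu>) = z)"
    by (simp only: lookup_sum lookup_single)
  also have "\<dots> = (\<Sum>\<mu> | mbar lam \<mu> \<noteq> 0.
      if \<mu> = - tr_part z then (if fin_part z = 1 then mbar lam \<mu> else 0) else 0)"
    by (rule sum.cong) (auto simp: t_def when_def xaff.expand)
  also have "\<dots> = (if fin_part z = 1 then mbar lam (- tr_part z) else 0)"
    by (simp add: finite_mbar)
  finally show ?thesis .
qed

lemma coset_iff: "z \<in> coset y \<longleftrightarrow> tr_part z - tr_part y \<in> root_lattice"
proof
  assume "z \<in> coset y"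
  then obtain u \<beta> where z: "z = Xaff u \<beta> * y" and "\<beta> \<in> root_lattice"
    by (auto simp: coset_def affine_weyl_def simp flip: xaff_semidirect(1))
  then have "act (inverse (fin_part y)) \<beta> \<in> root_lattice"
    by (simp add: act_root_lattice)
  then show "tr_part z - tr_part y \<in> root_lattice"
    by (simp add: z times_xaff_def)
next
  let ?v = "fin_part y" and ?\<beta> = "tr_part z - tr_part y"
  assume "?\<beta> \<in> root_lattice"
  then have "act ?v ?\<beta> \<in> root_lattice"
    by (simp add: act_root_lattice)
  moreover have "z = Xaff (fin_part z * inverse ?v) (act ?v ?\<beta>) * y"
    by (simp add: times_xaff_def mult.assoc)
  ultimately show "z \<in> coset y"
    unfolding coset_def affine_weyl_def xaff_semidirect(1) by blast
qed

lemma coset_mult_fin: "coset (y * fin w) = coset y"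
proof -
  have "tr_part z - tr_part (y * fin w) = (tr_part z - tr_part y)
      + - (act (inverse w) (tr_part y) - tr_part y)" for z
    by (simp add: times_xaff_def fin_def)
  moreover have "tr_part z - tr_part y = (tr_part z - tr_part (y * fin w))
      + (act (inverse w) (tr_part y) - tr_part y)" for z
    by (simp add: times_xaff_def fin_def)
  ultimately show ?thesis
    unfolding coset_iff set_eq_iff
    by (metis act_diff_root_lattice root_lattice_add root_lattice_uminus)
qed

lemma iota_mult_fin: "\<iota> (y * fin w) = inverse w \<odot> \<iota> y"
  by (simp add: iota_def times_xaff_def fin_def shifted_act_def inverse_weyl_mult act_zscale
      act_uminus act_add)

lemma chi_coeff:
  "(\<Sum>w\<in>UNIV. wdet w * ch_V (y * fin w) z) = (if z \<in> coset y then mbar (\<iota> y) (\<iota> z) else 0)"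
proof -
  have "(\<Sum>w\<in>UNIV. wdet w * int (kostant (inverse w \<odot> \<iota> y - \<iota> z))) = mbar (\<iota> y) (\<iota> z)"
    unfolding mbar_def
    by (rule sum.reindex_bij_witness[of _ inverse inverse]) (auto simp: wdet_inverse)
  then show ?thesis by (simp add: ch_V_def coset_mult_fin iota_mult_fin)
qed

lemma finite_chi_coeff: "finite {z. (\<Sum>w\<in>UNIV. wdet w * ch_V (y * fin w) z) \<noteq> 0}"
proof -
  have inj: "inj (\<lambda>\<beta>. \<iota> (Xaff u \<beta>))" for u
    by (auto simp: inj_on_def iota_def zscale_def prod_eq_iff)
  have "{z. (\<Sum>w\<in>UNIV. wdet w * ch_V (y * fin w) z) \<noteq> 0}
      \<subseteq> (\<Union>u. Xaff u ` ((\<lambda>\<beta>. \<iota> (Xaff u \<beta>)) -` {\<mu>. mbar (\<iota> y) \<mu> \<noteq> 0}))"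
  proof
    fix z
    assume "z \<in> {z. (\<Sum>w\<in>UNIV. wdet w * ch_V (y * fin w) z) \<noteq> 0}"
    then have "mbar (\<iota> y) (\<iota> z) \<noteq> 0" unfolding chi_coeff by (auto split: if_splits)
    then have "tr_part z \<in> (\<lambda>\<beta>. \<iota> (Xaff (fin_part z) \<beta>)) -` {\<mu>. mbar (\<iota> y) \<mu> \<noteq> 0}" by simp
    then show "z \<in> (\<Union>u. Xaff u ` ((\<lambda>\<beta>. \<iota> (Xaff u \<beta>)) -` {\<mu>. mbar (\<iota> y) \<mu> \<noteq> 0}))"
      using imageI[of "tr_part z" _ "Xaff (fin_part z)"] by (intro UN_I[of "fin_part z"]) simp_all
  qed
  then show ?thesis
    by (rule finite_subset) (intro finite_UN_I finite_imageI finite_vimageI finite_mbar inj finite)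
qed

lift_definition chi :: "xaff \<Rightarrow> group_ring"
  is "\<lambda>y z. \<Sum>w\<in>UNIV. wdet w * ch_V (y * fin w) z"
  by (rule finite_chi_coeff)

lemma lookup_chi: "Poly_Mapping.lookup (chi y) z = (if z \<in> coset y then mbar (\<iota> y) (\<iota> z) else 0)"
  unfolding chi.rep_eq chi_coeff ..

end

theory Submission
  imports Defs
begin

text \<open>
  Both sides of the identity are compared coefficient by coefficient, and the comparison takes
  place already at the level of partition functions.

  Because \<open>\<iota> x\<close> is the image of \<open>3 \<nu>\<close> under the shifted action of the inverse of the finite part of
  \<open>x\<close> (\<open>iota_fin_t\<close>), and weight multiplicities are antisymmetric under the shifted action
  (\<open>mbar_shifted_act\<close>), the coefficient of \<open>\<chi>\<^sub>x\<close> at an element \<open>u t\<^bsub>-\<mu>\<^esub>\<close> of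
  the coset of \<open>x\<close> is, up to the determinant, the multiplicity of \<open>3 \<mu> + u\<^sup>-\<^sup>1 \<rho> - \<rho>\<close> in the virtual
  character of highest weight \<open>3 \<nu>\<close>. The same antisymmetry exchanges the expression in \<open>\<nu>\<close> with the one in \<open>\<lambda>\<close>.

  What remains is to read off every third weight, with an offset depending on \<open>u\<close>, of a virtual
  character of highest weight \<open>3 \<nu>\<close>. The generating function of the partition function is a
  product of geometric series, and \<open>1 / (1 - X) = (1 + X + X\<^sup>2) / (1 - X\<^sup>3)\<close>. On coefficients: if
  \<open>\<theta>\<close> is used \<open>j\<close> modulo 3 times, then the residues of the multiplicities of the simple roots are
  determined, so a value of the partition function is a sum of three values at about a third
  of the argument, one for each \<open>j\<close> (\<open>kroot_div_3\<close>). For each of the six finite parts \<open>u\<close> this turns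
  the alternating sum for \<open>3 \<nu>\<close> into three alternating sums near \<open>\<nu>\<close>
  (\<open>mroot_times_3_residues\<close>). For the rotations \<open>u\<close> two of the three coincide and account for the
  \<open>2\<close> in \<open>F + 2\<close>, while the remaining one is among the first three characters. For the reflections
  \<open>u\<close> they come from the products of the three summands of \<open>F\<close> with \<open>1\<close>, \<open>\<gamma>\<close> and \<open>\<gamma>\<^sup>-\<^sup>1\<close> that have
  finite part \<open>u\<close> (\<open>chi_expansion_monomials\<close>).
\<close>

section \<open>Antisymmetry\<close>

lemma wdet_mult: "wdet (v * w) = wdet v * wdet w"
proof -
  have "\<forall>v w. wdet (v * w) = wdet v * wdet w"
    unfolding weyl_all wdet_def by (simp add: Lambda1_def Lambda2_def s_theta_def)
  then show ?thesis by blast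
qed

lemma wdet_cases: "wdet w = 1 \<or> wdet w = - 1"
proof -
  have "\<forall>w. wdet w = 1 \<or> wdet w = - 1" unfolding weyl_all by simp
  then show ?thesis ..
qed

lemma shifted_act_shifted_act: "v \<odot> w \<odot> lam = (v * w) \<odot> lam"
  by (simp add: shifted_act_def)

lemma mbar_shifted_act: "mbar (w \<odot> lam) \<mu> = wdet w * mbar lam \<mu>"
proof -
  have "mbar (w \<odot> lam) \<mu>
      = (\<Sum>v\<in>UNIV. wdet (v * inverse w) * int (kostant (v \<odot> lam - \<mu>)))"
    unfolding mbar_def shifted_act_shifted_act
    by (rule sum.reindex_bij_witness[of _ "\<lambda>v. v * inverse w" "\<lambda>v. v * w"])
      (simp_all add: mult.assoc)
  also have "\<dots> = wdet w * mbar lam \<mu>"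
    by (simp add: mbar_def wdet_mult wdet_inverse sum_distrib_left mult_ac)
  finally show ?thesis .
qed

lemma lookup_wdet_mult:
  "Poly_Mapping.lookup (of_int (wdet w) * p) z = wdet w * Poly_Mapping.lookup p z"
  for p :: group_ring
  using wdet_cases[of w] by auto

lemma chibar_shifted_act: "chibar (w \<odot> lam) = of_int (wdet w) * chibar lam"
  by (rule poly_mapping_eqI) (simp add: lookup_wdet_mult lookup_chibar mbar_shifted_act)

section \<open>Weight multiplicities in root coordinates\<close>

text \<open>In Dynkin labels, \<open>fst x - snd x\<close> modulo 3 is the class of \<open>x\<close> in the quotient of the weight
  lattice by the root lattice, which is cyclic of order 3.\<close>

lemma root_lattice_dvd: "x \<in> root_lattice \<longleftrightarrow> 3 dvd fst x - snd x"
proof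
  assume "x \<in> root_lattice"
  then obtain a b where "x = (2 * a - b, 2 * b - a)" by (auto simp: root_lattice_iff)
  then have "fst x - snd x = 3 * (a - b)" by simp
  then show "3 dvd fst x - snd x" by simp
next
  assume "3 dvd fst x - snd x"
  then obtain k where "fst x - snd x = 3 * k" by blast
  then have "x = (2 * (fst x - k) - (fst x - 2 * k), 2 * (fst x - 2 * k) - (fst x - k))"
    by (simp add: prod_eq_iff)
  then show "x \<in> root_lattice" unfolding root_lattice_iff by blast
qed

lemma mbar_eq_0:
  assumes "lam - \<mu> \<notin> root_lattice"
  shows "mbar lam \<mu> = 0"
proof -
  have "w \<odot> lam - \<mu> \<notin> root_lattice" for w
  proof
    assume "w \<odot> lam - \<mu> \<in> root_lattice"
    then have "(w \<odot> lam - \<mu>) + - (act w (lam + \<rho>) - (lam + \<rho>)) \<in> root_lattice"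
      by (intro root_lattice_add root_lattice_uminus act_diff_root_lattice)
    also have "(w \<odot> lam - \<mu>) + - (act w (lam + \<rho>) - (lam + \<rho>)) = lam - \<mu>"
      by (simp add: shifted_act_def)
    finally show False using assms by simp
  qed
  then show ?thesis by (simp add: mbar_def kostant_eq_0)
qed

text \<open>The partition function at \<open>a \<alpha>\<^sub>1 + b \<alpha>\<^sub>2\<close>: the multiplicity of \<open>\<theta>\<close> ranges over
  \<open>0, \<dots>, min a b\<close> and determines the other two. Written without a case distinction because this form
  commutes with division by 3.\<close>

definition kroot :: "int \<Rightarrow> int \<Rightarrow> int"
  where "kroot a b = max 0 (min a b + 1)"

text \<open>The alternating sum defining \<open>mbar lam \<mu>\<close> for \<open>lam + \<rho> = (p, q)\<close> and
  \<open>lam - \<mu> = a \<alpha>\<^sub>1 + b \<alpha>\<^sub>2\<close>: each Weyl group element \<open>w\<close> shifts \<open>(a, b)\<close> by the root coordinates of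
  \<open>w(lam + \<rho>) - (lam + \<rho>)\<close>.\<close>

definition mroot :: "int \<Rightarrow> int \<Rightarrow> int \<Rightarrow> int \<Rightarrow> int"
  where "mroot p q a b = kroot a b - kroot (a - p) b - kroot a (b - q)
    + kroot (a - p - q) (b - q) + kroot (a - p) (b - p - q) - kroot (a - p - q) (b - p - q)"

lemma mbar_mroot:
  assumes "lam - \<mu> = (2 * a - b, 2 * b - a)"
  shows "mbar lam \<mu> = mroot (fst lam + 1) (snd lam + 1) a b"
proof -
  obtain p q where lam: "lam = (p - 1, q - 1)"
    using that[of "fst lam + 1" "snd lam + 1"] by simp
  have mu: "\<mu> = (p - 1 - (2 * a - b), q - 1 - (2 * b - a))"
    using assms by (cases \<mu>) (auto simp: lam)
  have K: "int (kostant x) = kroot a' b'" if "x = (2 * a' - b', 2 * b' - a')" for x a' b'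
    unfolding that by (auto simp: kostant_root kroot_def)
  have "int (kostant (1 \<odot> lam - \<mu>)) = kroot a b"
    "int (kostant (w\<^sub>1 \<odot> lam - \<mu>)) = kroot (a - p) b"
    "int (kostant (w\<^sub>2 \<odot> lam - \<mu>)) = kroot a (b - q)"
    "int (kostant ((w\<^sub>1 * w\<^sub>2) \<odot> lam - \<mu>)) = kroot (a - p - q) (b - q)"
    "int (kostant ((w\<^sub>2 * w\<^sub>1) \<odot> lam - \<mu>)) = kroot (a - p) (b - p - q)"
    "int (kostant (w\<^sub>\<theta> \<odot> lam - \<mu>)) = kroot (a - p - q) (b - p - q)"
    by (rule K, simp add: shifted_act_def s_theta_def mu lam rho_def Lambda1_def Lambda2_def)+
  then show ?thesis
    unfolding mbar_def sum_weyl by (simp add: mroot_def lam)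
qed

section \<open>Passing to every third weight\<close>

text \<open>Sort the partitions of \<open>a \<alpha>\<^sub>1 + b \<alpha>\<^sub>2\<close> by the residue \<open>j\<close> modulo 3 of the multiplicity of \<open>\<theta>\<close>. Once
  \<open>j\<close> is fixed, the multiplicities of \<open>\<alpha>\<^sub>1\<close> and \<open>\<alpha>\<^sub>2\<close> have the residues of \<open>a - j\<close> and \<open>b - j\<close>, and
  the three quotients form an arbitrary partition with root coordinates \<open>(a - j) div 3\<close> and
  \<open>(b - j) div 3\<close>. In closed form this is Hermite's identity for \<open>min a b + 1\<close>.\<close>

lemma kroot_div_3: "kroot a b = (\<Sum>j\<in>{0, 1, 2}. kroot ((a - j) div 3) ((b - j) div 3))"
proof -
  have max: "max 0 (m + 1)
      = max 0 (m div 3 + 1) + max 0 ((m - 1) div 3 + 1) + max 0 ((m - 2) div 3 + 1)"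
    for m :: int
  proof -
    define k where "k = m div 3"
    have "m = 3 * k \<or> m = 3 * k + 1 \<or> m = 3 * k + 2"
      unfolding k_def by presburger
    then consider "m = 3 * k" | "m = 3 * k + 1" | "m = 3 * k + 2" by blast
    then show ?thesis
    proof cases
      case 1
      then have "m div 3 = k" "(m - 1) div 3 = k - 1" "(m - 2) div 3 = k - 1" by presburger+
      with 1 show ?thesis by (simp add: max_def)
    next
      case 2
      then have "m div 3 = k" "(m - 1) div 3 = k" "(m - 2) div 3 = k - 1" by presburger+
      with 2 show ?thesis by (simp add: max_def)
    next
      case 3
      then have "m div 3 = k" "(m - 1) div 3 = k" "(m - 2) div 3 = k" by presburger+
      with 3 show ?thesis by (simp add: max_def)
    qed
  qed
  have min: "min ((a - j) div 3) ((b - j) div 3) = (min a b - j) div 3" for j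
    by (cases "a \<le> b") (simp_all add: min_absorb1 min_absorb2 zdiv_mono1)
  have "(\<Sum>j\<in>{0, 1, 2}. f j) = f 0 + f 1 + f 2" for f :: "int \<Rightarrow> int"
    by simp
  then show ?thesis
    unfolding kroot_def min using max[of "min a b"] by (simp only: diff_0_right)
qed

lemma kroot_times_3:
  "kroot (3 * a + r) (3 * b + s)
    = (\<Sum>j\<in>{0, 1, 2}. kroot (a + (r - j) div 3) (b + (s - j) div 3))"
proof -
  have "(3 * c + t - j) div 3 = c + (t - j) div 3" for c t j :: int
    by presburger
  then show ?thesis by (intro trans[OF kroot_div_3]) simp
qed

text \<open>The highest weight is three times \<open>(p, q)\<close>, so \<open>\<rho>\<close> contributes \<open>1\<close>, not \<open>3\<close>, to each label. Hence
  the six shifts have root coordinates that differ modulo 3, and each summand on the right has its own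
  rounding.\<close>

lemma mroot_times_3:
  "mroot (3 * p + 1) (3 * q + 1) (3 * a + r) (3 * b + s)
    = (\<Sum>j\<in>{0, 1, 2}. kroot (a + (r - j) div 3) (b + (s - j) div 3)
      - kroot (a - p + (r - 1 - j) div 3) (b + (s - j) div 3)
      - kroot (a + (r - j) div 3) (b - q + (s - 1 - j) div 3)
      + kroot (a - p - q + (r - 2 - j) div 3) (b - q + (s - 1 - j) div 3)
      + kroot (a - p + (r - 1 - j) div 3) (b - p - q + (s - 2 - j) div 3)
      - kroot (a - p - q + (r - 2 - j) div 3) (b - p - q + (s - 2 - j) div 3))"
proof -
  have "3 * c + t - (3 * d + 1) = 3 * (c - d) + (t - 1)"
    "3 * c + t - (3 * d + 1) - (3 * e + 1) = 3 * (c - d - e) + (t - 2)" for c d e t :: int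
    by simp_all
  then show ?thesis
    by (simp only: mroot_def kroot_times_3 sum.distrib sum_subtractf)
qed

text \<open>The offset of \<open>(3 a, 3 b)\<close> is the pair of root coordinates of \<open>\<rho> - u\<^sup>-\<^sup>1 \<rho>\<close>; the offsets belong, in
  this order, to the finite parts \<open>1\<close>, \<open>w\<^sub>1 w\<^sub>2\<close>, \<open>w\<^sub>2 w\<^sub>1\<close>, \<open>w\<^sub>1\<close>, \<open>w\<^sub>2\<close> and \<open>w\<^sub>\<theta>\<close>. For each of them the
  roundings in \<open>mroot_times_3\<close> regroup, summand by summand of the alternating sum, into
  alternating sums of the original kind; only the pairing of the three residues \<open>j\<close> with the three
  sums changes from one Weyl group element to the next.\<close>

lemma mroot_times_3_residues:
  "mroot (3 * p + 1) (3 * q + 1) (3 * a) (3 * b)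
    = mroot (p + 1) (q + 1) a b + 2 * mroot p q (a - 1) (b - 1)"
  "mroot (3 * p + 1) (3 * q + 1) (3 * a + 1) (3 * b + 2)
    = mroot (p - 1) (q + 1) (a - 1) b + 2 * mroot (p + 1) q a b"
  "mroot (3 * p + 1) (3 * q + 1) (3 * a + 2) (3 * b + 1)
    = mroot (p + 1) (q - 1) a (b - 1) + 2 * mroot p (q + 1) a b"
  "mroot (3 * p + 1) (3 * q + 1) (3 * a + 1) (3 * b)
    = mroot p q (a - 1) (b - 1) + mroot (p + 1) q a (b - 1) + mroot p (q + 1) a b"
  "mroot (3 * p + 1) (3 * q + 1) (3 * a) (3 * b + 1)
    = mroot p q (a - 1) (b - 1) + mroot (p + 1) q a b + mroot p (q + 1) (a - 1) b"
  "mroot (3 * p + 1) (3 * q + 1) (3 * a + 2) (3 * b + 2)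
    = mroot p q a b + mroot (p + 1) q a b + mroot p (q + 1) a b"
proof -
  show "mroot (3 * p + 1) (3 * q + 1) (3 * a) (3 * b)
    = mroot (p + 1) (q + 1) a b + 2 * mroot p q (a - 1) (b - 1)"
    by (rule trans[OF trans[OF _ mroot_times_3[of p q a 0 b 0]]])
      (simp, simp add: mroot_def algebra_simps)
  show "mroot (3 * p + 1) (3 * q + 1) (3 * a + 1) (3 * b + 2)
    = mroot (p - 1) (q + 1) (a - 1) b + 2 * mroot (p + 1) q a b"
    by (rule trans[OF trans[OF _ mroot_times_3[of p q a 1 b 2]]])
      (simp, simp add: mroot_def algebra_simps)
  show "mroot (3 * p + 1) (3 * q + 1) (3 * a + 2) (3 * b + 1)
    = mroot (p + 1) (q - 1) a (b - 1) + 2 * mroot p (q + 1) a b"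
    by (rule trans[OF trans[OF _ mroot_times_3[of p q a 2 b 1]]])
      (simp, simp add: mroot_def algebra_simps)
  show "mroot (3 * p + 1) (3 * q + 1) (3 * a + 1) (3 * b)
    = mroot p q (a - 1) (b - 1) + mroot (p + 1) q a (b - 1) + mroot p (q + 1) a b"
    by (rule trans[OF trans[OF _ mroot_times_3[of p q a 1 b 0]]])
      (simp, simp add: mroot_def algebra_simps)
  show "mroot (3 * p + 1) (3 * q + 1) (3 * a) (3 * b + 1)
    = mroot p q (a - 1) (b - 1) + mroot (p + 1) q a b + mroot p (q + 1) (a - 1) b"
    by (rule trans[OF trans[OF _ mroot_times_3[of p q a 0 b 1]]])
      (simp, simp add: mroot_def algebra_simps)
  show "mroot (3 * p + 1) (3 * q + 1) (3 * a + 2) (3 * b + 2)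
    = mroot p q a b + mroot (p + 1) q a b + mroot p (q + 1) a b"
    by (rule trans[OF trans[OF _ mroot_times_3[of p q a 2 b 2]]])
      (simp, simp add: mroot_def algebra_simps)
qed

section \<open>Comparing coefficients\<close>

lemma gr_mult_left: "gr x * (gr y * p) = gr (x * y) * p"
  by (simp only: gr_mult flip: mult.assoc)

lemma lookup_gr_mult: "Poly_Mapping.lookup (gr x * p) z = Poly_Mapping.lookup p (inverse x * z)"
proof -
  have "Poly_Mapping.lookup (gr x * p) z
      = (\<Sum>k\<in>{x}. Poly_Mapping.lookup (gr x) k * (\<Sum>q. Poly_Mapping.lookup p q when z = k + q))"
    unfolding lookup_mult by (rule Sum_any.expand_superset) (auto simp: gr_def lookup_single when_def)
  also have "\<dots> = (\<Sum>q. Poly_Mapping.lookup p q when q = inverse x * z)"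
  proof -
    have "z = x + q \<longleftrightarrow> q = inverse x * z" for q
      unfolding plus_xaff_def by (metis mult.assoc mult_1 xaff_inverse)
    then show ?thesis by (simp add: gr_def)
  qed
  finally show ?thesis by simp
qed

lemma lookup_gr_chibar:
  "Poly_Mapping.lookup (gr (Xaff u \<tau>) * chibar lam) (Xaff v \<sigma>)
    = (if u = v then mbar lam (\<tau> - \<sigma>) else 0)"
proof -
  have "inverse u * v = 1 \<longleftrightarrow> u = v"
    by (metis inverse_inverse_weyl weyl_inverse(1) weyl_inverse_eqI)
  then show ?thesis
    by (auto simp: lookup_gr_mult lookup_chibar inverse_xaff_def times_xaff_def act_uminus)
qed

lemma weyl_products:
  "w\<^sub>1 * (w\<^sub>1 * w\<^sub>2) = w\<^sub>2" "w\<^sub>1 * (w\<^sub>2 * w\<^sub>1) = w\<^sub>\<theta>" "w\<^sub>2 * (w\<^sub>1 * w\<^sub>2) = w\<^sub>\<theta>"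
  "w\<^sub>2 * (w\<^sub>2 * w\<^sub>1) = w\<^sub>1" "w\<^sub>\<theta> * (w\<^sub>1 * w\<^sub>2) = w\<^sub>1" "w\<^sub>\<theta> * (w\<^sub>2 * w\<^sub>1) = w\<^sub>2"
  by (rule act_eqI, auto simp: s_theta_def fun_eq_iff)+

lemma gam_Xaff: "\<gamma> = Xaff (w\<^sub>1 * w\<^sub>2) (0, - 1)" "inverse \<gamma> = Xaff (w\<^sub>2 * w\<^sub>1) (- 1, 0)"
proof -
  show gam: "\<gamma> = Xaff (w\<^sub>1 * w\<^sub>2) (0, - 1)"
    by (simp add: gam_def times_xaff_def fin_def t_def Lambda1_def)
  show "inverse \<gamma> = Xaff (w\<^sub>2 * w\<^sub>1) (- 1, 0)"
    unfolding gam by (simp add: inverse_xaff_def inverse_weyl_mult)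
qed

lemma simple_reflections_Xaff:
  "w\<^sub>0 = Xaff w\<^sub>\<theta> (- 1, - 1)" "fin w\<^sub>1 = Xaff w\<^sub>1 (0, 0)" "fin w\<^sub>2 = Xaff w\<^sub>2 (0, 0)"
  by (simp_all add: w0_def times_xaff_def fin_def t_def theta_def alpha1_def alpha2_def zero_prod_def)

lemma simple_reflections_mult_gam:
  "w\<^sub>0 * \<gamma> = Xaff w\<^sub>1 (- 1, 1)" "w\<^sub>0 * inverse \<gamma> = Xaff w\<^sub>2 (1, - 1)"
  "fin w\<^sub>1 * \<gamma> = Xaff w\<^sub>2 (0, - 1)" "fin w\<^sub>1 * inverse \<gamma> = Xaff w\<^sub>\<theta> (- 1, 0)"
  "fin w\<^sub>2 * \<gamma> = Xaff w\<^sub>\<theta> (0, - 1)" "fin w\<^sub>2 * inverse \<gamma> = Xaff w\<^sub>1 (- 1, 0)"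
  unfolding simple_reflections_Xaff gam_Xaff(2)
  unfolding gam_Xaff(1)
  by (simp_all add: times_xaff_def inverse_weyl_mult weyl_products)

text \<open>The first expression claimed for \<open>\<chi>\<^sub>x\<close>, without its determinant.\<close>

definition chi_expansion :: "weight \<Rightarrow> group_ring"
  where "chi_expansion \<nu> = chibar \<nu> + gr \<gamma> * chibar (\<nu> - 2 *\<^sub>Z \<Lambda>\<^sub>1)
            + gr (inverse \<gamma>) * chibar (\<nu> - 2 *\<^sub>Z \<Lambda>\<^sub>2)
            + (F + 2) * (chibar (\<nu> - \<rho>) + gr \<gamma> * chibar (\<nu> - \<Lambda>\<^sub>2)
                         + gr (inverse \<gamma>) * chibar (\<nu> - \<Lambda>\<^sub>1))"

text \<open>Multiplied out and sorted by finite part: every summand is a group element times a character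
  supported on translations, so only the group elements with finite part \<open>u\<close> contribute to the
  coefficients at \<open>u t\<^bsub>-\<mu>\<^esub>\<close>.\<close>

lemma chi_expansion_monomials:
  "chi_expansion (p, q)
    = gr (Xaff 1 (0, 0)) * (chibar (p, q) + 2 * chibar (p - 1, q - 1))
    + gr (Xaff (w\<^sub>1 * w\<^sub>2) (0, - 1)) * (chibar (p - 2, q) + 2 * chibar (p, q - 1))
    + gr (Xaff (w\<^sub>2 * w\<^sub>1) (- 1, 0)) * (chibar (p, q - 2) + 2 * chibar (p - 1, q))
    + (gr (Xaff w\<^sub>1 (0, 0)) * chibar (p - 1, q - 1) + gr (Xaff w\<^sub>1 (- 1, 1)) * chibar (p, q - 1)
      + gr (Xaff w\<^sub>1 (- 1, 0)) * chibar (p - 1, q))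
    + (gr (Xaff w\<^sub>2 (0, 0)) * chibar (p - 1, q - 1) + gr (Xaff w\<^sub>2 (0, - 1)) * chibar (p, q - 1)
      + gr (Xaff w\<^sub>2 (1, - 1)) * chibar (p - 1, q))
    + (gr (Xaff w\<^sub>\<theta> (- 1, - 1)) * chibar (p - 1, q - 1)
      + gr (Xaff w\<^sub>\<theta> (0, - 1)) * chibar (p, q - 1)
      + gr (Xaff w\<^sub>\<theta> (- 1, 0)) * chibar (p - 1, q))"
proof -
  have F: "F * (a + gr \<gamma> * b + gr (inverse \<gamma>) * c) =
      (gr (Xaff w\<^sub>1 (0, 0)) * a + gr (Xaff w\<^sub>1 (- 1, 1)) * b + gr (Xaff w\<^sub>1 (- 1, 0)) * c)
    + (gr (Xaff w\<^sub>2 (0, 0)) * a + gr (Xaff w\<^sub>2 (0, - 1)) * b + gr (Xaff w\<^sub>2 (1, - 1)) * c)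
    + (gr (Xaff w\<^sub>\<theta> (- 1, - 1)) * a + gr (Xaff w\<^sub>\<theta> (0, - 1)) * b + gr (Xaff w\<^sub>\<theta> (- 1, 0)) * c)"
    for a b c
    by (simp only: F_def distrib_left distrib_right gr_mult_left simple_reflections_mult_gam)
      (simp only: simple_reflections_Xaff add_ac)
  have one: "gr (Xaff 1 (0, 0)) * a = a" for a
    using gr_one by (simp add: one_xaff_def zero_prod_def)
  have two: "2 * (a + gr g * b + gr h * c) = 2 * a + gr g * (2 * b) + gr h * (2 * c)"
    for a b c g h
    by (simp add: distrib_left mult_2)
  have weights: "(p, q) - 2 *\<^sub>Z \<Lambda>\<^sub>1 = (p - 2, q)" "(p, q) - 2 *\<^sub>Z \<Lambda>\<^sub>2 = (p, q - 2)"
    "(p, q) - \<rho> = (p - 1, q - 1)" "(p, q) - \<Lambda>\<^sub>1 = (p - 1, q)" "(p, q) - \<Lambda>\<^sub>2 = (p, q - 1)"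
    by (simp_all add: weight_defs)
  show ?thesis
    unfolding chi_expansion_def distrib_right[of F 2] F two weights one
    unfolding distrib_left gam_Xaff(2)
    unfolding gam_Xaff(1) by (simp only: add_ac)
qed

lemma lookup_chi_expansion_Xaff:
  "Poly_Mapping.lookup (chi_expansion (p, q)) (Xaff 1 (- m, - n))
    = mbar (p, q) (m, n) + 2 * mbar (p - 1, q - 1) (m, n)"
  "Poly_Mapping.lookup (chi_expansion (p, q)) (Xaff (w\<^sub>1 * w\<^sub>2) (- m, - n))
    = mbar (p - 2, q) (m, n - 1) + 2 * mbar (p, q - 1) (m, n - 1)"
  "Poly_Mapping.lookup (chi_expansion (p, q)) (Xaff (w\<^sub>2 * w\<^sub>1) (- m, - n))
    = mbar (p, q - 2) (m - 1, n) + 2 * mbar (p - 1, q) (m - 1, n)"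
  "Poly_Mapping.lookup (chi_expansion (p, q)) (Xaff w\<^sub>1 (- m, - n))
    = mbar (p - 1, q - 1) (m, n) + mbar (p, q - 1) (m - 1, n + 1) + mbar (p - 1, q) (m - 1, n)"
  "Poly_Mapping.lookup (chi_expansion (p, q)) (Xaff w\<^sub>2 (- m, - n))
    = mbar (p - 1, q - 1) (m, n) + mbar (p, q - 1) (m, n - 1) + mbar (p - 1, q) (m + 1, n - 1)"
  "Poly_Mapping.lookup (chi_expansion (p, q)) (Xaff w\<^sub>\<theta> (- m, - n))
    = mbar (p - 1, q - 1) (m - 1, n - 1) + mbar (p, q - 1) (m, n - 1) + mbar (p - 1, q) (m - 1, n)"
proof -
  have two: "Poly_Mapping.lookup (gr g * (a + 2 * b)) z
      = Poly_Mapping.lookup (gr g * a) z + 2 * Poly_Mapping.lookup (gr g * b) z" for g a b z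
    by (simp only: distrib_left mult_2 lookup_add)
  \<comment> \<open>The reversed list supplies the inequations to the simplifier in the opposite orientation.\<close>
  have distinct_rev: "distinct [w\<^sub>\<theta>, w\<^sub>2 * w\<^sub>1, w\<^sub>1 * w\<^sub>2, w\<^sub>2, w\<^sub>1, 1]"
    using weyl_distinct by auto
  show "Poly_Mapping.lookup (chi_expansion (p, q)) (Xaff 1 (- m, - n))
    = mbar (p, q) (m, n) + 2 * mbar (p - 1, q - 1) (m, n)"
    using weyl_distinct distinct_rev
    by (simp add: chi_expansion_monomials lookup_add two lookup_gr_chibar
        add.commute[of 1])
  show "Poly_Mapping.lookup (chi_expansion (p, q)) (Xaff (w\<^sub>1 * w\<^sub>2) (- m, - n))
    = mbar (p - 2, q) (m, n - 1) + 2 * mbar (p, q - 1) (m, n - 1)"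
    using weyl_distinct distinct_rev
    by (simp add: chi_expansion_monomials lookup_add two lookup_gr_chibar
        add.commute[of 1])
  show "Poly_Mapping.lookup (chi_expansion (p, q)) (Xaff (w\<^sub>2 * w\<^sub>1) (- m, - n))
    = mbar (p, q - 2) (m - 1, n) + 2 * mbar (p - 1, q) (m - 1, n)"
    using weyl_distinct distinct_rev
    by (simp add: chi_expansion_monomials lookup_add two lookup_gr_chibar
        add.commute[of 1])
  show "Poly_Mapping.lookup (chi_expansion (p, q)) (Xaff w\<^sub>1 (- m, - n))
    = mbar (p - 1, q - 1) (m, n) + mbar (p, q - 1) (m - 1, n + 1) + mbar (p - 1, q) (m - 1, n)"
    using weyl_distinct distinct_rev
    by (simp add: chi_expansion_monomials lookup_add two lookup_gr_chibar
        add.commute[of 1])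
  show "Poly_Mapping.lookup (chi_expansion (p, q)) (Xaff w\<^sub>2 (- m, - n))
    = mbar (p - 1, q - 1) (m, n) + mbar (p, q - 1) (m, n - 1) + mbar (p - 1, q) (m + 1, n - 1)"
    using weyl_distinct distinct_rev
    by (simp add: chi_expansion_monomials lookup_add two lookup_gr_chibar
        add.commute[of 1])
  show "Poly_Mapping.lookup (chi_expansion (p, q)) (Xaff w\<^sub>\<theta> (- m, - n))
    = mbar (p - 1, q - 1) (m - 1, n - 1) + mbar (p, q - 1) (m, n - 1) + mbar (p - 1, q) (m - 1, n)"
    using weyl_distinct distinct_rev
    by (simp add: chi_expansion_monomials lookup_add two lookup_gr_chibar
        add.commute[of 1])
qed

lemma iota_Xaff:
  "\<iota> (Xaff 1 (- m, - n)) = (3 * m, 3 * n)"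
  "\<iota> (Xaff (w\<^sub>1 * w\<^sub>2) (- m, - n)) = (3 * m, 3 * n - 3)"
  "\<iota> (Xaff (w\<^sub>2 * w\<^sub>1) (- m, - n)) = (3 * m - 3, 3 * n)"
  "\<iota> (Xaff w\<^sub>1 (- m, - n)) = (3 * m - 2, 3 * n + 1)"
  "\<iota> (Xaff w\<^sub>2 (- m, - n)) = (3 * m + 1, 3 * n - 2)"
  "\<iota> (Xaff w\<^sub>\<theta> (- m, - n)) = (3 * m - 2, 3 * n - 2)"
  by (simp_all add: iota_def shifted_act_def inverse_weyl_mult s_theta_def[symmetric] zscale_def
      rho_def Lambda1_def Lambda2_def zero_prod_def)
    (simp_all add: s_theta_def)

text \<open>Each multiplicity is moved to root coordinates, where the six cases are the six cases of
  \<open>mroot_times_3_residues\<close>.\<close>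

lemma lookup_chi_expansion_coset:
  assumes "\<nu> + tr_part z \<in> root_lattice"
  shows "Poly_Mapping.lookup (chi_expansion \<nu>) z = mbar (3 *\<^sub>Z \<nu>) (\<iota> z)"
proof -
  obtain p q where nu: "\<nu> = (p, q)" by (cases \<nu>)
  obtain v m n where z: "z = Xaff v (- m, - n)"
    using that[of "fin_part z" "- fst (tr_part z)" "- snd (tr_part z)"] by simp
  obtain a b where "\<nu> + tr_part z = (2 * a - b, 2 * b - a)"
    using assms by (auto simp: root_lattice_iff)
  then have mn: "m = p - (2 * a - b)" "n = q - (2 * b - a)"
    by (simp_all add: nu z)
  have M: "mbar (p', q') \<mu> = mroot (p' + 1) (q' + 1) a' b'"
    if "\<mu> = (p' - (2 * a' - b'), q' - (2 * b' - a'))" for p' q' \<mu> a' b'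
    using mbar_mroot[of "(p', q')" \<mu> a' b'] that by simp
  have "v \<in> {1, w\<^sub>1 * w\<^sub>2, w\<^sub>2 * w\<^sub>1, w\<^sub>1, w\<^sub>2, w\<^sub>\<theta>}"
    using UNIV_weyl by blast
  then show ?thesis
    unfolding nu z
  proof (elim insertE emptyE; hypsubst)
    show "Poly_Mapping.lookup (chi_expansion (p, q)) (Xaff 1 (- m, - n))
      = mbar (3 *\<^sub>Z (p, q)) (\<iota> (Xaff 1 (- m, - n)))"
      unfolding lookup_chi_expansion_Xaff iota_Xaff zscale_def fst_conv snd_conv
      by (subst M[where a' = a and b' = b], simp add: mn,
          subst M[where a' = "a - 1" and b' = "b - 1"], simp add: mn,
          subst M[where a' = "3 * a" and b' = "3 * b"], simp add: mn)
        (simp add: mroot_times_3_residues)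
  next
    show "Poly_Mapping.lookup (chi_expansion (p, q)) (Xaff (w\<^sub>1 * w\<^sub>2) (- m, - n))
      = mbar (3 *\<^sub>Z (p, q)) (\<iota> (Xaff (w\<^sub>1 * w\<^sub>2) (- m, - n)))"
      unfolding lookup_chi_expansion_Xaff iota_Xaff zscale_def fst_conv snd_conv
      by (subst M[where a' = "a - 1" and b' = b], simp add: mn,
          subst M[where a' = a and b' = b], simp add: mn,
          subst M[where a' = "3 * a + 1" and b' = "3 * b + 2"], simp add: mn)
        (simp add: mroot_times_3_residues)
  next
    show "Poly_Mapping.lookup (chi_expansion (p, q)) (Xaff (w\<^sub>2 * w\<^sub>1) (- m, - n))
      = mbar (3 *\<^sub>Z (p, q)) (\<iota> (Xaff (w\<^sub>2 * w\<^sub>1) (- m, - n)))"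
      unfolding lookup_chi_expansion_Xaff iota_Xaff zscale_def fst_conv snd_conv
      by (subst M[where a' = a and b' = "b - 1"], simp add: mn,
          subst M[where a' = a and b' = b], simp add: mn,
          subst M[where a' = "3 * a + 2" and b' = "3 * b + 1"], simp add: mn)
        (simp add: mroot_times_3_residues)
  next
    show "Poly_Mapping.lookup (chi_expansion (p, q)) (Xaff w\<^sub>1 (- m, - n))
      = mbar (3 *\<^sub>Z (p, q)) (\<iota> (Xaff w\<^sub>1 (- m, - n)))"
      unfolding lookup_chi_expansion_Xaff iota_Xaff zscale_def fst_conv snd_conv
      by (subst M[where a' = "a - 1" and b' = "b - 1"], simp add: mn,
          subst M[where a' = a and b' = "b - 1"], simp add: mn,
          subst M[where a' = a and b' = b], simp add: mn,
          subst M[where a' = "3 * a + 1" and b' = "3 * b"], simp add: mn)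
        (simp add: mroot_times_3_residues)
  next
    show "Poly_Mapping.lookup (chi_expansion (p, q)) (Xaff w\<^sub>2 (- m, - n))
      = mbar (3 *\<^sub>Z (p, q)) (\<iota> (Xaff w\<^sub>2 (- m, - n)))"
      unfolding lookup_chi_expansion_Xaff iota_Xaff zscale_def fst_conv snd_conv
      by (subst M[where a' = "a - 1" and b' = "b - 1"], simp add: mn,
          subst M[where a' = a and b' = b], simp add: mn,
          subst M[where a' = "a - 1" and b' = b], simp add: mn,
          subst M[where a' = "3 * a" and b' = "3 * b + 1"], simp add: mn)
        (simp add: mroot_times_3_residues)
  next
    show "Poly_Mapping.lookup (chi_expansion (p, q)) (Xaff w\<^sub>\<theta> (- m, - n))
      = mbar (3 *\<^sub>Z (p, q)) (\<iota> (Xaff w\<^sub>\<theta> (- m, - n)))"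
      unfolding lookup_chi_expansion_Xaff iota_Xaff zscale_def fst_conv snd_conv
      by (subst M[where a' = a and b' = b], simp add: mn,
          subst M[where a' = a and b' = b], simp add: mn,
          subst M[where a' = a and b' = b], simp add: mn,
          subst M[where a' = "3 * a + 2" and b' = "3 * b + 2"], simp add: mn)
        (simp add: mroot_times_3_residues)
  qed
qed

text \<open>In every multiplicity that enters the coefficient at \<open>z\<close>, the highest weight and the weight
  differ by \<open>\<nu> + tr_part z\<close> up to the root lattice.\<close>

lemma lookup_chi_expansion_eq_0:
  assumes "\<nu> + tr_part z \<notin> root_lattice"
  shows "Poly_Mapping.lookup (chi_expansion \<nu>) z = 0"
proof -
  obtain p q where nu: "\<nu> = (p, q)" by (cases \<nu>)
  obtain v m n where z: "z = Xaff v (- m, - n)"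
    using that[of "fin_part z" "- fst (tr_part z)" "- snd (tr_part z)"] by simp
  have "\<not> 3 dvd (p - m) - (q - n)"
    using assms by (simp add: nu z root_lattice_dvd)
  then have M: "mbar (p', q') (m', n') = 0"
    if "3 dvd (p' - m') - (q' - n') - ((p - m) - (q - n))" for p' q' m' n'
    using that by (intro mbar_eq_0) (simp add: root_lattice_dvd, presburger)
  have "v \<in> {1, w\<^sub>1 * w\<^sub>2, w\<^sub>2 * w\<^sub>1, w\<^sub>1, w\<^sub>2, w\<^sub>\<theta>}"
    using UNIV_weyl by blast
  then show ?thesis
    unfolding nu z
    by (elim insertE emptyE; hypsubst) (simp_all add: lookup_chi_expansion_Xaff M)
qed

lemma lookup_chi_expansion:
  "Poly_Mapping.lookup (chi_expansion \<nu>) z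
    = (if \<nu> + tr_part z \<in> root_lattice then mbar (3 *\<^sub>Z \<nu>) (\<iota> z) else 0)"
  by (simp add: lookup_chi_expansion_coset lookup_chi_expansion_eq_0)

lemma iota_fin_t: "\<iota> (fin w * t (- lam)) = inverse w \<odot> 3 *\<^sub>Z act w lam"
  by (simp add: iota_def fin_def t_def times_xaff_def shifted_act_def act_add act_zscale)

lemma chi_eq_chi_expansion:
  "chi (fin w * t (- lam)) = of_int (wdet w) * chi_expansion (act w lam)"
proof (rule poly_mapping_eqI)
  fix z
  have "z \<in> coset (fin w * t (- lam)) \<longleftrightarrow> act w lam + tr_part z \<in> root_lattice"
  proof -
    have "tr_part z - tr_part (fin w * t (- lam)) = (act w lam + tr_part z) + - (act w lam - lam)"
      "act w lam + tr_part z = tr_part z - tr_part (fin w * t (- lam)) + (act w lam - lam)"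
      by (simp_all add: fin_def t_def times_xaff_def)
    then show ?thesis
      unfolding coset_iff
      by (metis act_diff_root_lattice root_lattice_add root_lattice_uminus)
  qed
  then show "Poly_Mapping.lookup (chi (fin w * t (- lam))) z
      = Poly_Mapping.lookup (of_int (wdet w) * chi_expansion (act w lam)) z"
    by (simp add: lookup_chi lookup_wdet_mult lookup_chi_expansion iota_fin_t mbar_shifted_act
        wdet_inverse)
qed

lemma chibar_add_shifted_act:
  "chibar (lam + inverse w \<odot> \<kappa>) = of_int (wdet w) * chibar (act w lam + \<kappa>)"
proof -
  have "lam + inverse w \<odot> \<kappa> = inverse w \<odot> (act w lam + \<kappa>)"
    by (simp add: shifted_act_def act_add)
  then show ?thesis by (simp only: chibar_shifted_act wdet_inverse)
qed

theorem proposition3p1: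
  fixes x :: xaff and xb :: weyl and lam \<nu> :: weight
  assumes "x = fin xb * t (- lam)" and "x = t (- \<nu>) * fin xb"
    and "\<nu> = act xb lam"
    and "x \<in> W_plus"
  shows "chi x = of_int (wdet xb) *
           (chibar \<nu> + gr \<gamma> * chibar (\<nu> - 2 *\<^sub>Z \<Lambda>\<^sub>1) + gr (inverse \<gamma>) * chibar (\<nu> - 2 *\<^sub>Z \<Lambda>\<^sub>2)
            + (F + 2) * (chibar (\<nu> - \<rho>) + gr \<gamma> * chibar (\<nu> - \<Lambda>\<^sub>2)
                         + gr (inverse \<gamma>) * chibar (\<nu> - \<Lambda>\<^sub>1)))
       \<and> of_int (wdet xb) *
           (chibar \<nu> + gr \<gamma> * chibar (\<nu> - 2 *\<^sub>Z \<Lambda>\<^sub>1) + gr (inverse \<gamma>) * chibar (\<nu> - 2 *\<^sub>Z \<Lambda>\<^sub>2)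
            + (F + 2) * (chibar (\<nu> - \<rho>) + gr \<gamma> * chibar (\<nu> - \<Lambda>\<^sub>2)
                         + gr (inverse \<gamma>) * chibar (\<nu> - \<Lambda>\<^sub>1)))
         = chibar (lam + inverse xb \<odot> 0)
           + gr \<gamma> * chibar (lam + inverse xb \<odot> (- (2 *\<^sub>Z \<Lambda>\<^sub>1)))
           + gr (inverse \<gamma>) * chibar (lam + inverse xb \<odot> (- (2 *\<^sub>Z \<Lambda>\<^sub>2)))
           + (F + 2) * (chibar (lam + inverse xb \<odot> (- \<rho>))
                        + gr \<gamma> * chibar (lam + inverse xb \<odot> (- \<Lambda>\<^sub>2))
                        + gr (inverse \<gamma>) * chibar (lam + inverse xb \<odot> (- \<Lambda>\<^sub>1)))"
proof -
  have chi: "chi x = of_int (wdet xb) * chi_expansion \<nu>"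
    using assms(1,3) by (simp only: chi_eq_chi_expansion)
  have "chibar (lam + inverse xb \<odot> \<kappa>) = of_int (wdet xb) * chibar (\<nu> + \<kappa>)" for \<kappa>
    using assms(3) by (simp only: chibar_add_shifted_act)
  then show ?thesis
    using chi wdet_cases[of xb] by (auto simp: chi_expansion_def distrib_left)
qed

end
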